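(* Let $(W,S)$ be a Coxeter system of finite rank with $m_{rt}<\infty$ for all $r,t\in S$. Let $V$ be an IR-representation of $(W,S)$ defined by the datum $(k_{rt},a_r^t)_{r\ne t\in S}$, and let $\chi$ be the corresponding character of $\mathrm{H}_1(\widetilde G)$. Assume $\widetilde G$ is connected. (1) $V$ has a nonzero $W$-invariant bilinear form if and only if $\chi(\mathrm{H}_1(\widetilde G))\subseteq\{\pm1\}$. (2) $V$ has a nonzero $W$-invariant sesquilinear form if and only if $\chi(\mathrm{H}_1(\widetilde G))\subseteq S^1$, where $S^1=\{z\in\mathbb{C}:|z|=1\}$.
   Context: $W=\langle S\mid s^2=(st)^{m_{st}}=e,\ \forall s\ne t\in S\rangle$. All representations are complex. IR-representation: a representation $V$ of $W$ having a basis $\{\alpha_s\mid s\in S\}$ such that for every $s\in S$ there is a subspace $H_s$ of codimension $1$ with $s|_{H_s}=\mathrm{Id}_{H_s}$, and $s\cdot\alpha_s=-\alpha_s$. Every such $V$ is defined by a datum $(k_{rt},a_r^t)_{r\neq t}$ with $k_{rt}=k_{tr}\in\mathbb{N}$, $1\le k_{rt}\le m_{rt}/2$, $a_r^t\in\mathbb{C}^\times$, via $r\cdot\alpha_r=-\alpha_r$ and $r\cdot\alpha_t=\alpha_t+2\frac{a_r^t}{a_t^r}\cos\frac{k_{rt}\pi}{m_{rt}}\alpha_r$ for $t\ne r$. $\widetilde G$ is the graph with vertex set $S$ in which $\{r,t\}$ is an edge iff $m_{rt}/\gcd(m_{rt},k_{rt})\ge3$ (equivalently $k_{rt}\ne m_{rt}/2$).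 $\mathrm{H}_1(\widetilde G)$ is its first integral homology (as a 1-dimensional simplicial complex), and $\chi:\mathrm{H}_1(\widetilde G)\to\mathbb{C}^\times$ is the restriction of the homomorphism on 1-chains sending the oriented edge $(r,t)$ to $a_t^r/a_r^t$. *)

theory Defs
  imports Complex_Main "HOL-Algebra.Generated_Groups" "Graph_Theory.Digraph_Component"
begin

section \<open>Coxeter systems\<close>

text \<open>A letter \<open>(s, True)\<close> stands for \<open>s\<close> and \<open>(s, False)\<close> for its formal inverse.\<close>

type_synonym 's word = "('s \<times> bool) list"

definition word_value :: "('s, 'b) monoid_scheme \<Rightarrow> 's word \<Rightarrow> 's" where
  "word_value W w =
     foldr (\<lambda>(s, b) x. (if b then s else inv\<^bsub>W\<^esub> s) \<otimes>\<^bsub>W\<^esub> x) w \<one>\<^bsub>W\<^esub>"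

text \<open>Two words are related iff they represent the same element of \<open>\<langle>S | R\<rangle>\<close>.\<close>

inductive presentation_eq :: "'s set \<Rightarrow> 's word set \<Rightarrow> 's word \<Rightarrow> 's word \<Rightarrow> bool"
  for S R where
  refl: "presentation_eq S R w w"
| sym: "presentation_eq S R v w \<Longrightarrow> presentation_eq S R w v"
| trans: "presentation_eq S R u v \<Longrightarrow> presentation_eq S R v w \<Longrightarrow> presentation_eq S R u w"
| cancel: "s \<in> S \<Longrightarrow> presentation_eq S R (u @ [(s, b), (s, \<not> b)] @ v) (u @ v)"
| relator: "r \<in> R \<Longrightarrow> presentation_eq S R (u @ r @ v) (u @ v)"

definition group_presentation :: "('s, 'b) monoid_scheme \<Rightarrow> 's set \<Rightarrow> 's word set \<Rightarrow> bool" where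
  "group_presentation W S R \<longleftrightarrow>
     group W \<and> S \<subseteq> carrier W \<and> generate W S = carrier W \<and>
     (\<forall>r\<in>R. word_value W r = \<one>\<^bsub>W\<^esub>) \<and>
     (\<forall>w \<in> lists (S \<times> UNIV). word_value W w = \<one>\<^bsub>W\<^esub> \<longrightarrow> presentation_eq S R w [])"

text \<open>The entry \<open>m s t = 0\<close> encodes \<open>m\<^sub>s\<^sub>t = \<infinity>\<close> (as for element orders in
  HOL-Algebra); the corresponding relator is then the empty word.\<close>

definition coxeter_matrix :: "'s set \<Rightarrow> ('s \<Rightarrow> 's \<Rightarrow> nat) \<Rightarrow> bool" where
  "coxeter_matrix S m \<longleftrightarrow>
     (\<forall>s\<in>S. m s s = 1) \<and> (\<forall>s\<in>S. \<forall>t\<in>S. m s t = m t s \<and> (s \<noteq> t \<longrightarrow> m s t \<noteq> 1))"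

definition coxeter_relators :: "'s set \<Rightarrow> ('s \<Rightarrow> 's \<Rightarrow> nat) \<Rightarrow> 's word set" where
  "coxeter_relators S m =
     {[(s, True), (s, True)] | s. s \<in> S} \<union>
     {concat (replicate (m s t) [(s, True), (t, True)]) | s t. s \<in> S \<and> t \<in> S \<and> s \<noteq> t}"

definition coxeter_system ::
  "('s, 'b) monoid_scheme \<Rightarrow> 's set \<Rightarrow> ('s \<Rightarrow> 's \<Rightarrow> nat) \<Rightarrow> bool" where
  "coxeter_system W S m \<longleftrightarrow>
     coxeter_matrix S m \<and> group_presentation W S (coxeter_relators S m)"

section \<open>Complex representations and invariant forms\<close>

text \<open>A complex vector space is a type \<open>'v\<close> together with a scalar multiplication \<open>scale\<close>.\<close>

definition GL :: "(complex \<Rightarrow> 'v \<Rightarrow> 'v::ab_group_add) \<Rightarrow> ('v \<Rightarrow> 'v) monoid" where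
  "GL scale = \<lparr>carrier = {f. Vector_Spaces.linear scale scale f \<and> bij f},
     monoid.mult = (\<circ>), one = id\<rparr>"

definition representation ::
  "('s, 'b) monoid_scheme \<Rightarrow> (complex \<Rightarrow> 'v \<Rightarrow> 'v::ab_group_add) \<Rightarrow> ('s \<Rightarrow> 'v \<Rightarrow> 'v) \<Rightarrow> bool" where
  "representation W scale \<rho> \<longleftrightarrow> vector_space scale \<and> \<rho> \<in> hom W (GL scale)"

text \<open>For infinite-dimensional \<open>'v\<close> the library sets \<open>dim UNIV = 0\<close>, so the codimension condition
  is only satisfiable in finite dimension.\<close>

definition IR_representation ::
  "('s, 'b) monoid_scheme \<Rightarrow> 's set \<Rightarrow> (complex \<Rightarrow> 'v \<Rightarrow> 'v::ab_group_add) \<Rightarrow>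
   ('s \<Rightarrow> 'v \<Rightarrow> 'v) \<Rightarrow> ('s \<Rightarrow> 'v) \<Rightarrow> bool" where
  "IR_representation W S scale \<rho> \<alpha> \<longleftrightarrow>
     representation W scale \<rho> \<and>
     inj_on \<alpha> S \<and> \<not> module.dependent scale (\<alpha> ` S) \<and> module.span scale (\<alpha> ` S) = UNIV \<and>
     (\<forall>s\<in>S. (\<exists>H. module.subspace scale H \<and>
                 vector_space.dim scale H + 1 = vector_space.dim scale UNIV \<and>
                 (\<forall>x\<in>H. \<rho> s x = x)) \<and>
            \<rho> s (\<alpha> s) = - \<alpha> s)"

text \<open>Here \<open>k r t\<close> is \<open>k\<^sub>r\<^sub>t\<close> and \<open>a r t\<close> is \<open>a\<^sub>r\<^sup>t\<close>: the first argument is the subscript.\<close>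

definition IR_datum ::
  "'s set \<Rightarrow> ('s \<Rightarrow> 's \<Rightarrow> nat) \<Rightarrow> ('s \<Rightarrow> 's \<Rightarrow> nat) \<Rightarrow> ('s \<Rightarrow> 's \<Rightarrow> complex) \<Rightarrow> bool" where
  "IR_datum S m k a \<longleftrightarrow>
     (\<forall>r\<in>S. \<forall>t\<in>S. r \<noteq> t \<longrightarrow>
        k r t = k t r \<and> 1 \<le> k r t \<and> real (k r t) \<le> real (m r t) / 2 \<and> a r t \<noteq> 0)"

definition defined_by_datum ::
  "'s set \<Rightarrow> ('s \<Rightarrow> 's \<Rightarrow> nat) \<Rightarrow> (complex \<Rightarrow> 'v \<Rightarrow> 'v::ab_group_add) \<Rightarrow>
   ('s \<Rightarrow> 'v \<Rightarrow> 'v) \<Rightarrow> ('s \<Rightarrow> 'v) \<Rightarrow>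
   ('s \<Rightarrow> 's \<Rightarrow> nat) \<Rightarrow> ('s \<Rightarrow> 's \<Rightarrow> complex) \<Rightarrow> bool" where
  "defined_by_datum S m scale \<rho> \<alpha> k a \<longleftrightarrow>
     (\<forall>r\<in>S. \<rho> r (\<alpha> r) = - \<alpha> r) \<and>
     (\<forall>r\<in>S. \<forall>t\<in>S. t \<noteq> r \<longrightarrow>
        \<rho> r (\<alpha> t) =
          \<alpha> t + scale (2 * (a r t / a t r) *
                        complex_of_real (cos (real (k r t) * pi / real (m r t)))) (\<alpha> r))"

definition bilinear_form ::
  "(complex \<Rightarrow> 'v \<Rightarrow> 'v::ab_group_add) \<Rightarrow> ('v \<Rightarrow> 'v \<Rightarrow> complex) \<Rightarrow> bool" where
  "bilinear_form scale B \<longleftrightarrow>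
     (\<forall>y. Vector_Spaces.linear scale (*) (\<lambda>x. B x y)) \<and>
     (\<forall>x. Vector_Spaces.linear scale (*) (\<lambda>y. B x y))"

text \<open>Sesquilinear forms are conjugate-linear in the second argument.\<close>

definition sesquilinear_form ::
  "(complex \<Rightarrow> 'v \<Rightarrow> 'v::ab_group_add) \<Rightarrow> ('v \<Rightarrow> 'v \<Rightarrow> complex) \<Rightarrow> bool" where
  "sesquilinear_form scale B \<longleftrightarrow>
     (\<forall>y. Vector_Spaces.linear scale (*) (\<lambda>x. B x y)) \<and>
     (\<forall>x. Vector_Spaces.linear scale (*) (\<lambda>y. cnj (B x y)))"

definition invariant_form ::
  "('s, 'b) monoid_scheme \<Rightarrow> ('s \<Rightarrow> 'v \<Rightarrow> 'v) \<Rightarrow> ('v \<Rightarrow> 'v \<Rightarrow> complex) \<Rightarrow> bool" where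
  "invariant_form W \<rho> B \<longleftrightarrow> (\<forall>w\<in>carrier W. \<forall>x y. B (\<rho> w x) (\<rho> w y) = B x y)"

definition nonzero_form :: "('v \<Rightarrow> 'v \<Rightarrow> complex) \<Rightarrow> bool" where
  "nonzero_form B \<longleftrightarrow> (\<exists>x y. B x y \<noteq> 0)"

section \<open>The graph, its homology and the character\<close>

text \<open>An undirected graph is a symmetric digraph; each edge occurs in both orientations.\<close>

definition Gtilde ::
  "'s set \<Rightarrow> ('s \<Rightarrow> 's \<Rightarrow> nat) \<Rightarrow> ('s \<Rightarrow> 's \<Rightarrow> nat) \<Rightarrow> 's pair_pre_digraph" where
  "Gtilde S m k = \<lparr>pverts = S,
     parcs = {(r, t). r \<in> S \<and> t \<in> S \<and> r \<noteq> t \<and> m r t div gcd (m r t) (k r t) \<ge> 3}\<rparr>"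

text \<open>Simplicial chains of a finite graph. As usual, 1-chains are the alternating integer functions
  on oriented edges: the oriented edge \<open>(r, t)\<close> is the function with value \<open>1\<close> at \<open>(r, t)\<close>,
  \<open>-1\<close> at \<open>(t, r)\<close> and \<open>0\<close> elsewhere.\<close>

definition chains0 :: "'s pair_pre_digraph \<Rightarrow> ('s \<Rightarrow> int) monoid" where
  "chains0 G = \<lparr>carrier = {c. \<forall>v. v \<notin> pverts G \<longrightarrow> c v = 0},
     monoid.mult = (\<lambda>c d v. c v + d v), one = (\<lambda>v. 0)\<rparr>"

definition chains1 :: "'s pair_pre_digraph \<Rightarrow> ('s \<times> 's \<Rightarrow> int) monoid" where
  "chains1 G = \<lparr>carrier = {c. (\<forall>e. e \<notin> parcs G \<longrightarrow> c e = 0) \<and> (\<forall>r t. c (t, r) = - c (r, t))},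
     monoid.mult = (\<lambda>c d e. c e + d e), one = (\<lambda>e. 0)\<rparr>"

definition oriented_edge :: "'s \<Rightarrow> 's \<Rightarrow> 's \<times> 's \<Rightarrow> int" where
  "oriented_edge r t = (\<lambda>e. if e = (r, t) then 1 else if e = (t, r) then -1 else 0)"

text \<open>The linear extension of \<open>(r, t) \<mapsto> t - r\<close>.\<close>

definition boundary1 :: "'s pair_pre_digraph \<Rightarrow> ('s \<times> 's \<Rightarrow> int) \<Rightarrow> 's \<Rightarrow> int" where
  "boundary1 G c = (\<lambda>v. if v \<in> pverts G then \<Sum>u\<in>pverts G. c (u, v) else 0)"

text \<open>A graph has no 2-simplices, so there are no 1-boundaries to divide out.\<close>

definition H1 :: "'s pair_pre_digraph \<Rightarrow> ('s \<times> 's \<Rightarrow> int) monoid" where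
  "H1 G = (chains1 G)\<lparr>carrier := kernel (chains1 G) (chains0 G) (boundary1 G)\<rparr>"

text \<open>The homomorphism on 1-chains sending the oriented edge \<open>(r, t)\<close> to \<open>a\<^sub>t\<^sup>r / a\<^sub>r\<^sup>t\<close>. The product
  is over unoriented edges; both orientations of an edge give the same factor \<open>z\<close>, because \<open>c\<close> is
  alternating and the values of \<open>(r, t)\<close> and \<open>(t, r)\<close> are mutually inverse.\<close>

definition chi ::
  "'s pair_pre_digraph \<Rightarrow> ('s \<Rightarrow> 's \<Rightarrow> complex) \<Rightarrow> ('s \<times> 's \<Rightarrow> int) \<Rightarrow> complex" where
  "chi G a c =
     (\<Prod>e \<in> {{r, t} | r t. (r, t) \<in> parcs G}.
        THE z. \<forall>r t. e = {r, t} \<longrightarrow> z = (a t r / a r t) powi c (r, t))"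

definition Cstar :: "complex monoid" where
  "Cstar = \<lparr>carrier = UNIV - {0}, monoid.mult = (*), one = 1\<rparr>"

lemma chains1_carrier:
  "c \<in> carrier (chains1 G) \<longleftrightarrow>
     (\<forall>e. e \<notin> parcs G \<longrightarrow> c e = 0) \<and> (\<forall>r t. c (t, r) = - c (r, t))"
  by (simp only: chains1_def partial_object.simps mem_Collect_eq)

lemma chains1_mult: "c \<otimes>\<^bsub>chains1 G\<^esub> d = (\<lambda>e. c e + d e)"
  by (simp add: chains1_def)

lemma chains1_add:
  assumes "c \<in> carrier (chains1 G)" "d \<in> carrier (chains1 G)"
  shows "c \<otimes>\<^bsub>chains1 G\<^esub> d \<in> carrier (chains1 G)"
  unfolding chains1_carrier chains1_mult
proof (intro conjI allI impI)
  fix r t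
  have "c (t, r) = - c (r, t)" "d (t, r) = - d (r, t)"
    using assms unfolding chains1_carrier by blast+
  thus "c (t, r) + d (t, r) = - (c (r, t) + d (r, t))" by linarith
next
  fix e assume "e \<notin> parcs G"
  hence "c e = 0" "d e = 0"
    using assms unfolding chains1_carrier by blast+
  thus "c e + d e = 0" by linarith
qed

lemma chi_factor:
  fixes a :: "'s \<Rightarrow> 's \<Rightarrow> complex"
  assumes "c \<in> carrier (chains1 G)"
  shows "(THE z. \<forall>r t. {x, y} = {r, t} \<longrightarrow> z = (a t r / a r t) powi c (r, t))
    = (a y x / a x y) powi c (x, y)"
proof (rule the_equality)
  have "c (y, x) = - c (x, y)"
    using assms unfolding chains1_carrier by blast
  hence "(a x y / a y x) powi c (y, x) = (a y x / a x y) powi c (x, y)"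
    by (simp add: power_int_minus power_int_divide_distrib)
  thus "\<forall>r t. {x, y} = {r, t} \<longrightarrow>
      (a y x / a x y) powi c (x, y) = (a t r / a r t) powi c (r, t)"
    by (auto simp: doubleton_eq_iff)
qed blast

lemma chi_hom:
  assumes "\<And>r t. (r, t) \<in> parcs G \<Longrightarrow> a r t \<noteq> 0 \<and> a t r \<noteq> 0" and "finite (parcs G)"
  shows "chi G a \<in> hom (chains1 G) Cstar"
proof (rule homI)
  let ?E = "{{r, t} | r t. (r, t) \<in> parcs G}"
  have "?E = (\<lambda>(r, t). {r, t}) ` parcs G" by auto
  hence fin: "finite ?E" using assms(2) by simp
  fix c assume c: "c \<in> carrier (chains1 G)"
  show "chi G a c \<in> carrier Cstar"
    using fin assms(1) by (auto simp: chi_def Cstar_def chi_factor[OF c] power_int_eq_0_iff)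
  fix d assume d: "d \<in> carrier (chains1 G)"
  have cd: "c \<otimes>\<^bsub>chains1 G\<^esub> d \<in> carrier (chains1 G)"
    using c d by (rule chains1_add)
  show "chi G a (c \<otimes>\<^bsub>chains1 G\<^esub> d) = chi G a c \<otimes>\<^bsub>Cstar\<^esub> chi G a d"
  proof -
    let ?f = "\<lambda>c e. THE z. \<forall>r t. e = {r, t} \<longrightarrow> z = (a t r / a r t) powi c (r, t)"
    have "?f (c \<otimes>\<^bsub>chains1 G\<^esub> d) e = ?f c e * ?f d e" if "e \<in> ?E" for e
    proof -
      from that obtain r t where e: "e = {r, t}" "(r, t) \<in> parcs G" by blast
      have "a t r / a r t \<noteq> 0" using assms(1) e(2) by simp
      thus ?thesis
        unfolding e(1) chi_factor[OF c] chi_factor[OF d] chi_factor[OF cd]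
        by (simp add: chains1_mult power_int_add)
    qed
    thus ?thesis
      by (simp add: chi_def Cstar_def flip: prod.distrib)
  qed
qed

lemma chi_oriented_edge:
  assumes "(r, t) \<in> parcs G" "(t, r) \<in> parcs G" "r \<noteq> t" "finite (parcs G)"
  shows "oriented_edge r t \<in> carrier (chains1 G)"
    and "chi G a (oriented_edge r t) = a t r / a r t"
proof -
  show c: "oriented_edge r t \<in> carrier (chains1 G)"
    using assms unfolding chains1_carrier by (auto simp: oriented_edge_def)
  let ?E = "{{r, t} | r t. (r, t) \<in> parcs G}"
  have "?E = (\<lambda>(r, t). {r, t}) ` parcs G" by auto
  hence fin: "finite ?E" using assms(4) by simp
  have "chi G a (oriented_edge r t) = (\<Prod>e\<in>?E. if e = {r, t} then a t r / a r t else 1)"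
    unfolding chi_def
  proof (rule prod.cong[OF HOL.refl])
    fix e assume "e \<in> ?E"
    then obtain x y where e: "e = {x, y}" by blast
    have "(a y x / a x y) powi oriented_edge r t (x, y)
        = (if {x, y} = {r, t} then a t r / a r t else 1)"
      using assms(3) by (auto simp: oriented_edge_def doubleton_eq_iff power_int_minus)
    thus "(THE z. \<forall>r' t'. e = {r', t'} \<longrightarrow>
            z = (a t' r' / a r' t') powi oriented_edge r t (r', t'))
        = (if e = {r, t} then a t r / a r t else 1)"
      unfolding e chi_factor[OF c] .
  qed
  also have "\<dots> = a t r / a r t"
    using fin assms(1) by auto
  finally show "chi G a (oriented_edge r t) = a t r / a r t" .
qed

lemma boundary1_hom: "boundary1 G \<in> hom (chains1 G) (chains0 G)"
  by (auto simp: hom_def boundary1_def chains0_def chains1_mult sum.distrib)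

lemma boundary1_oriented_edge:
  assumes "r \<in> pverts G" "t \<in> pverts G" "r \<noteq> t" "finite (pverts G)"
  shows "boundary1 G (oriented_edge r t) = (\<lambda>v. if v = t then 1 else if v = r then -1 else 0)"
proof
  fix v
  have "(\<Sum>u\<in>pverts G. oriented_edge r t (u, v))
      = (\<Sum>u\<in>pverts G. (if u = r then if v = t then 1 else 0 else 0)
          - (if u = t then if v = r then 1 else 0 else 0))"
    by (rule sum.cong) (use assms in \<open>auto simp: oriented_edge_def\<close>)
  also have "\<dots> = (if v = t then 1 else if v = r then -1 else 0)"
    using assms by (auto simp: sum_subtractf)
  finally show "boundary1 G (oriented_edge r t) v = (if v = t then 1 else if v = r then -1 else 0)"
    using assms by (auto simp: boundary1_def)
qed

end

theory Submission
  imports Defs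
begin

text \<open>Let \<open>\<sigma>\<close> be the identity or complex conjugation, and consider forms that are linear in the first
  and \<open>\<sigma>\<close>-linear in the second argument. Invariance under a generator \<open>r\<close> determines \<open>B \<alpha>\<^sub>r \<alpha>\<^sub>t\<close> and
  \<open>B \<alpha>\<^sub>t \<alpha>\<^sub>r\<close> from \<open>B \<alpha>\<^sub>r \<alpha>\<^sub>r\<close>, so an invariant form amounts to diagonal values \<open>b\<^sub>r\<close> for which the
  prescriptions coming from \<open>r\<close> and from \<open>t\<close> agree; this is a condition on edges only, namely
  \<open>b\<^sub>r a\<^sub>r\<^sup>t \<sigma>(a\<^sub>r\<^sup>t) = b\<^sub>t a\<^sub>t\<^sup>r \<sigma>(a\<^sub>t\<^sup>r)\<close>. Such a nonzero \<open>b\<close> is a potential for the multiplicative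
  1-cochain \<open>\<chi> \<sigma>(\<chi>)\<close>, and on a connected graph a potential exists iff the cochain is trivial on
  all cycles. Finally \<open>z \<sigma>(z) = 1\<close> means \<open>z = \<plusminus>1\<close> for the identity and \<open>|z| = 1\<close> for conjugation.\<close>

section \<open>Multiplicative potentials, and \<open>chi\<close> as a product over edges\<close>

text \<open>The equation is cleared of denominators, so that it makes sense before \<open>b\<close>
  is known to vanish nowhere. Where nothing vanishes, it says that the factor
  \<open>a t r / a r t\<close> of the edge \<open>(r, t)\<close> equals
  \<open>b r / b t\<close>.\<close>

definition balanced :: "'s pair_pre_digraph \<Rightarrow> ('s \<Rightarrow> 's \<Rightarrow> complex) \<Rightarrow> ('s \<Rightarrow> complex) \<Rightarrow> bool" where
  "balanced G a b \<longleftrightarrow> (\<forall>(r, t)\<in>parcs G. b r * a r t = b t * a t r)"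

definition edges :: "'s pair_pre_digraph \<Rightarrow> 's set set" where
  "edges G = {{r, t} | r t. (r, t) \<in> parcs G}"

text \<open>A name for the factors in \<open>chi\<close>; below, the definite description is
  evaluated only through \<open>edge_factor_doubleton\<close>.\<close>

definition edge_factor :: "('s \<Rightarrow> 's \<Rightarrow> complex) \<Rightarrow> ('s \<times> 's \<Rightarrow> int) \<Rightarrow> 's set \<Rightarrow> complex" where
  "edge_factor a c e = (THE z. \<forall>r t. e = {r, t} \<longrightarrow> z = (a t r / a r t) powi c (r, t))"

lemma chi_eq_prod_edge_factor: "chi G a c = prod (edge_factor a c) (edges G)"
  unfolding chi_def edges_def edge_factor_def ..

lemma edge_factor_doubleton:
  assumes "c \<in> carrier (chains1 G)"
  shows "edge_factor a c {r, t} = (a t r / a r t) powi c (r, t)"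
  unfolding edge_factor_def by (rule chi_factor[OF assms])

text \<open>Together with \<open>chi_cnj\<close> this expresses the character attached to
  \<open>a r t * \<sigma> (a r t)\<close> by the one attached to \<open>a\<close>.\<close>

lemma chi_mult:
  assumes "c \<in> carrier (chains1 G)"
  shows "chi G (\<lambda>r t. a r t * a' r t) c = chi G a c * chi G a' c"
  unfolding chi_eq_prod_edge_factor prod.distrib[symmetric]
proof (rule prod.cong)
  fix e assume "e \<in> edges G"
  then obtain r t where "e = {r, t}" by (auto simp: edges_def)
  then show "edge_factor (\<lambda>r t. a r t * a' r t) c e = edge_factor a c e * edge_factor a' c e"
    by (simp add: edge_factor_doubleton[OF assms] power_int_mult_distrib[symmetric])
qed simp

lemma chi_cnj:
  assumes "c \<in> carrier (chains1 G)"
  shows "chi G (\<lambda>r t. cnj (a r t)) c = cnj (chi G a c)"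
  unfolding chi_eq_prod_edge_factor cnj_prod
proof (rule prod.cong)
  fix e assume "e \<in> edges G"
  then obtain r t where "e = {r, t}" by (auto simp: edges_def)
  then show "edge_factor (\<lambda>r t. cnj (a r t)) c e = cnj (edge_factor a c e)"
    by (simp add: edge_factor_doubleton[OF assms])
qed simp

lemma power_int_sum:
  fixes x :: "'a :: field"
  assumes "x \<noteq> 0"
  shows "x powi (\<Sum>i\<in>A. f i) = (\<Prod>i\<in>A. x powi f i)"
  by (induction A rule: infinite_finite_induct) (simp_all add: assms power_int_add)

lemma carrier_H1: "c \<in> carrier (H1 G) \<longleftrightarrow>
    c \<in> carrier (chains1 G) \<and> boundary1 G c = (\<lambda>v. 0)"
  by (simp add: H1_def kernel_def chains0_def)

section \<open>Potentials and the values of \<open>chi\<close> on cycles\<close>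

context pair_graph
begin

text \<open>A potential turns the product over edges into a product over vertices, in which the
  exponent of \<open>b v\<close> is minus the boundary coefficient at \<open>v\<close>. On a cycle
  all these exponents are 0.\<close>

lemma chi_eq_1_if_balanced:
  assumes c: "c \<in> carrier (H1 G)"
    and b: "balanced G a b" "\<And>v. v \<in> pverts G \<Longrightarrow> b v \<noteq> 0"
    and a: "\<And>r t. (r, t) \<in> parcs G \<Longrightarrow> a r t \<noteq> 0"
  shows "chi G a c = 1"
proof -
  have c1: "c \<in> carrier (chains1 G)" and c0: "boundary1 G c = (\<lambda>v. 0)"
    using c by (simp_all add: carrier_H1)
  have zero: "c p = 0" if "p \<notin> parcs G" for p
    using c1 that unfolding chains1_carrier by blast
  have anti: "c (t, r) = - c (r, t)" for r t
    using c1 unfolding chains1_carrier by blast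
  have sym: "(t, r) \<in> parcs G" if "(r, t) \<in> parcs G" for r t
    using that arcs_symmetric by auto
  let ?h = "\<lambda>p. b (fst p) powi c p"
  have fin: "finite (parcs G)" "finite (edges G)"
  proof -
    have "edges G = (\<lambda>(r, t). {r, t}) ` parcs G" by (auto simp: edges_def)
    then show "finite (parcs G)" "finite (edges G)" by simp_all
  qed
  \<comment> \<open>Because \<open>c\<close> is alternating,
    \<open>(b r / b t) powi c (r, t)\<close> splits into one contribution per orientation, each
    attached to the starting vertex.\<close>
  have factor: "edge_factor a c e = (\<Prod>p\<in>{p \<in> parcs G. {fst p, snd p} = e}. ?h p)"
    if "e \<in> edges G" for e
  proof -
    from that obtain r t where e: "e = {r, t}" "(r, t) \<in> parcs G" by (auto simp: edges_def)
    have ne: "r \<noteq> t" using e(2) no_loops' by blast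
    have nz: "b r \<noteq> 0" "b t \<noteq> 0" "a r t \<noteq> 0" "a t r \<noteq> 0"
      using e(2) sym[OF e(2)] a b(2) in_arcsD1 in_arcsD2 by blast+
    have "{p \<in> parcs G. {fst p, snd p} = e} = {(r, t), (t, r)}"
      using e sym by (auto simp: doubleton_eq_iff)
    then have "(\<Prod>p\<in>{p \<in> parcs G. {fst p, snd p} = e}. ?h p)
        = b r powi c (r, t) * b t powi c (t, r)"
      using ne by simp
    also have "\<dots> = (b r / b t) powi c (r, t)"
      unfolding anti[of t r] by (simp add: power_int_minus power_int_divide_distrib field_simps)
    also have "b r / b t = a t r / a r t"
      using b(1) e(2) nz by (auto simp: balanced_def field_simps)
    finally show ?thesis by (simp add: e(1) edge_factor_doubleton[OF c1])
  qed
  have "chi G a c = (\<Prod>e\<in>edges G. \<Prod>p\<in>{p \<in> parcs G. {fst p, snd p} = e}. ?h p)"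
    unfolding chi_eq_prod_edge_factor by (rule prod.cong) (simp_all add: factor)
  also have "\<dots> = (\<Prod>p\<in>parcs G. ?h p)"
    by (rule prod.group) (use fin in \<open>auto, auto simp: edges_def\<close>)
  \<comment> \<open>Pairs that are not arcs carry exponent 0 and contribute 1; adding them allows
    sorting by first vertex.\<close>
  also have "\<dots> = (\<Prod>p\<in>pverts G \<times> pverts G. ?h p)"
    by (rule prod.mono_neutral_left) (auto simp: zero dest: in_arcsD1 in_arcsD2)
  also have "\<dots> = (\<Prod>v\<in>pverts G. \<Prod>u\<in>pverts G. b v powi c (v, u))"
    by (simp add: prod.cartesian_product case_prod_beta)
  also have "\<dots> = (\<Prod>v\<in>pverts G. 1)"
  proof (rule prod.cong)
    fix v assume v: "v \<in> pverts G"
    \<comment> \<open>The exponents run over outgoing edges, whereas \<open>boundary1\<close> sums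
      over incoming ones; alternation supplies the sign.\<close>
    have "(\<Sum>u\<in>pverts G. c (v, u)) = - (\<Sum>u\<in>pverts G. c (u, v))"
      unfolding sum_negf[symmetric] by (rule sum.cong[OF HOL.refl anti])
    also have "\<dots> = - boundary1 G c v" using v by (simp add: boundary1_def)
    also have "\<dots> = 0" by (simp add: c0)
    finally show "(\<Prod>u\<in>pverts G. b v powi c (v, u)) = 1"
      by (simp add: power_int_sum[symmetric] b(2)[OF v])
  qed simp
  finally show ?thesis by simp
qed

text \<open>\<open>connected\<close> refers to the symmetric closure, which adds no reachability
  here since the arcs are already symmetric.\<close>

lemma connected_reachable:
  assumes "connected (with_proj G)" "u \<in> pverts G" "v \<in> pverts G"
  shows "u \<rightarrow>\<^sup>*\<^bsub>with_proj G\<^esub> v"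
proof -
  have "u \<rightarrow>\<^sup>*\<^bsub>with_proj (mk_symmetric (with_proj G))\<^esub> v"
    using assms by (simp add: connected_def strongly_connected_def)
  then show ?thesis by (simp only: reachable_mk_symmetric_eq[OF sym_arcs])
qed

text \<open>On an arc the equation has nonzero coefficients, so nonvanishing passes from one end to
  the other and hence along walks.\<close>

lemma balanced_nonzero:
  assumes conn: "connected (with_proj G)"
    and b: "balanced G a b"
    and a: "\<And>r t. (r, t) \<in> parcs G \<Longrightarrow> a r t \<noteq> 0"
    and u: "u \<in> pverts G" "b u \<noteq> 0" and v: "v \<in> pverts G"
  shows "b v \<noteq> 0"
  using connected_reachable[OF conn u(1) v]
proof (induction rule: reachable_induct)
  case base
  show ?case by (rule u)
next
  case (step x y)
  have "(x, y) \<in> parcs G" using step by simp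
  then have "b x * a x y = b y * a y x" "a x y \<noteq> 0"
    using b a by (auto simp: balanced_def)
  then show ?case using step by auto
qed

text \<open>The chain is the sum of the oriented edges of a walk, whose boundary telescopes. A
  difference of indicator functions also covers \<open>u = v\<close>.\<close>

lemma chain_from_to:
  assumes "u \<rightarrow>\<^sup>*\<^bsub>with_proj G\<^esub> v"
  shows "\<exists>c\<in>carrier (chains1 G).
    boundary1 G c = (\<lambda>x. (if x = v then 1 else 0) - (if x = u then 1 else 0))"
  using assms
proof (induction rule: reachable_induct)
  case base
  show ?case
    by (rule bexI[of _ "\<lambda>_. 0"]) (auto simp: boundary1_def chains1_carrier)
next
  case (step x y)
  then obtain c where c: "c \<in> carrier (chains1 G)"
    "boundary1 G c = (\<lambda>z. (if z = x then 1 else 0) - (if z = u then 1 else 0))"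
    by blast
  have xy: "(x, y) \<in> parcs G" "(y, x) \<in> parcs G" "x \<noteq> y" "x \<in> pverts G" "y \<in> pverts G"
    using step arcs_symmetric no_loops' in_arcsD1 in_arcsD2 by auto
  have o: "oriented_edge x y \<in> carrier (chains1 G)"
    using xy by (simp add: chi_oriented_edge)
  let ?d = "c \<otimes>\<^bsub>chains1 G\<^esub> oriented_edge x y"
  have "boundary1 G ?d = (\<lambda>z. boundary1 G c z + boundary1 G (oriented_edge x y) z)"
    using hom_mult[OF boundary1_hom c(1) o] by (simp add: chains0_def)
  also have "\<dots> = (\<lambda>z. (if z = y then 1 else 0) - (if z = u then 1 else 0))"
    using xy by (auto simp: boundary1_oriented_edge c(2))
  finally show ?case using chains1_add[OF c(1) o] by blast
qed

text \<open>As in integrating a closed form: fix a base vertex and evaluate \<open>chi\<close> on a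
  chain leading from it to \<open>v\<close>. Triviality on cycles makes these values compatible
  across each edge.\<close>

lemma balanced_if_chi_eq_1:
  assumes conn: "connected (with_proj G)"
    and chi: "\<And>c. c \<in> carrier (H1 G) \<Longrightarrow> chi G a c = 1"
    and a: "\<And>r t. (r, t) \<in> parcs G \<Longrightarrow> a r t \<noteq> 0"
  obtains b where "balanced G a b" "\<And>v. v \<in> pverts G \<Longrightarrow> b v \<noteq> 0"
proof -
  \<comment> \<open>Connectedness includes the existence of a vertex.\<close>
  obtain u where u: "u \<in> pverts G"
    using conn by (auto simp: connected_def strongly_connected_def)
  have "\<forall>v\<in>pverts G. \<exists>c. c \<in> carrier (chains1 G) \<and>
    boundary1 G c = (\<lambda>x. (if x = v then 1 else 0) - (if x = u then 1 else 0))"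
    using chain_from_to[OF connected_reachable[OF conn u]] by blast
  then obtain c where c: "\<And>v. v \<in> pverts G \<Longrightarrow> c v \<in> carrier (chains1 G)"
    "\<And>v. v \<in> pverts G \<Longrightarrow>
      boundary1 G (c v) = (\<lambda>x. (if x = v then 1 else 0) - (if x = u then 1 else 0))"
    by metis
  have a': "(r, t) \<in> parcs G \<Longrightarrow> a r t \<noteq> 0 \<and> a t r \<noteq> 0" for r t
    using a arcs_symmetric by blast
  have chi_hom: "chi G a \<in> hom (chains1 G) Cstar"
    by (rule chi_hom) (use a' in auto)
  note hom = hom_mult[OF chi_hom]
  have nz: "chi G a (c v) \<noteq> 0" if "v \<in> pverts G" for v
    using hom_in_carrier[OF chi_hom c(1)[OF that]] by (simp add: Cstar_def)
  \<comment> \<open>The reciprocal is taken because the factor of \<open>(r, t)\<close> must be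
    \<open>b r / b t\<close>, while extending a chain from \<open>r\<close> to \<open>t\<close>
    multiplies \<open>chi\<close> by that factor.\<close>
  let ?b = "\<lambda>v. 1 / chi G a (c v)"
  have "balanced G a ?b"
    unfolding balanced_def
  proof safe
    fix r t assume rt: "(r, t) \<in> parcs G"
    have xy: "(t, r) \<in> parcs G" "r \<noteq> t" and v: "r \<in> pverts G" "t \<in> pverts G"
      using rt arcs_symmetric no_loops' in_arcsD1 in_arcsD2 by auto
    have o: "oriented_edge r t \<in> carrier (chains1 G)"
      "chi G a (oriented_edge r t) = a t r / a r t"
      using rt xy by (simp_all add: chi_oriented_edge)
    \<comment> \<open>\<open>?z\<close> is the closed chain that goes from the base vertex to
      \<open>r\<close>, along the edge to \<open>t\<close>, and back by \<open>?n\<close>.\<close>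
    let ?n = "\<lambda>p. - c t p"
    let ?d = "c r \<otimes>\<^bsub>chains1 G\<^esub> oriented_edge r t"
    let ?z = "?d \<otimes>\<^bsub>chains1 G\<^esub> ?n"
    have n: "?n \<in> carrier (chains1 G)"
      using c(1)[OF v(2)] unfolding chains1_carrier by (metis neg_equal_iff_equal minus_zero)
    have d: "?d \<in> carrier (chains1 G)" by (rule chains1_add[OF c(1)[OF v(1)] o(1)])
    have "boundary1 G ?n = (\<lambda>x. - boundary1 G (c t) x)"
      by (auto simp: boundary1_def sum_negf)
    then have "boundary1 G ?z = (\<lambda>x. 0)"
      using hom_mult[OF boundary1_hom d n] hom_mult[OF boundary1_hom c(1)[OF v(1)] o(1)] v xy
      by (auto simp: chains0_def boundary1_oriented_edge c(2))
    then have "?z \<in> carrier (H1 G)" using chains1_add[OF d n] by (simp add: carrier_H1)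
    then have "chi G a ?z = 1" by (rule chi)
    then have 1: "chi G a (c r) * (a t r / a r t) * chi G a ?n = 1"
      using hom[OF d n] hom[OF c(1)[OF v(1)] o(1)] by (simp add: Cstar_def o(2))
    \<comment> \<open>The zero chain is a cycle too; the hypothesis on it shows that
      \<open>chi\<close> takes inverse values at \<open>c t\<close> and \<open>?n\<close>.\<close>
    have "(\<lambda>_. 0) \<in> carrier (H1 G)"
      by (auto simp: carrier_H1 chains1_carrier boundary1_def)
    moreover have "c t \<otimes>\<^bsub>chains1 G\<^esub> ?n = (\<lambda>_. 0)" by (simp add: chains1_mult)
    ultimately have 2: "chi G a (c t) * chi G a ?n = 1"
      using hom[OF c(1)[OF v(2)] n] chi by (simp add: Cstar_def)
    have "chi G a (c r) * (a t r / a r t) = chi G a (c t)"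
      using 1 2 by (metis mult_right_cancel mult_zero_right zero_neq_one)
    then show "?b r * a r t = ?b t * a t r"
      using a'[OF rt] nz[OF v(1)] nz[OF v(2)] by (simp add: field_simps)
  qed
  then show ?thesis using that[of ?b] nz by simp
qed

lemma chi_trivial_iff_balanced:
  assumes "connected (with_proj G)"
    and "\<And>r t. (r, t) \<in> parcs G \<Longrightarrow> a r t \<noteq> 0"
  shows "(\<forall>c\<in>carrier (H1 G). chi G a c = 1) \<longleftrightarrow>
    (\<exists>b. balanced G a b \<and> (\<forall>v\<in>pverts G. b v \<noteq> 0))"
proof
  assume "\<forall>c\<in>carrier (H1 G). chi G a c = 1"
  then obtain b where "balanced G a b" "\<And>v. v \<in> pverts G \<Longrightarrow> b v \<noteq> 0"
    using balanced_if_chi_eq_1[where a = a, OF assms(1) _ assms(2)] by blast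
  then show "\<exists>b. balanced G a b \<and> (\<forall>v\<in>pverts G. b v \<noteq> 0)" by blast
next
  assume "\<exists>b. balanced G a b \<and> (\<forall>v\<in>pverts G. b v \<noteq> 0)"
  then obtain b where b: "balanced G a b" "\<And>v. v \<in> pverts G \<Longrightarrow> b v \<noteq> 0" by blast
  show "\<forall>c\<in>carrier (H1 G). chi G a c = 1"
    using chi_eq_1_if_balanced[OF _ b assms(2)] by blast
qed

end

section \<open>Forms that are linear in the first and \<sigma>-linear in the second argument\<close>

locale conj_twist =
  fixes \<sigma> :: "complex \<Rightarrow> complex"
  assumes id_or_cnj: "\<sigma> = id \<or> \<sigma> = cnj"
begin

lemma twist_simps [simp]:
  "\<sigma> (x + y) = \<sigma> x + \<sigma> y" "\<sigma> (x * y) = \<sigma> x * \<sigma> y" "\<sigma> (x / y) = \<sigma> x / \<sigma> y"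
  "\<sigma> (- x) = - \<sigma> x" "\<sigma> (of_real z) = of_real z" "\<sigma> (numeral n) = numeral n"
  "\<sigma> 0 = 0" "\<sigma> (\<sigma> x) = x" "\<sigma> x = 0 \<longleftrightarrow> x = 0"
  using id_or_cnj by auto

lemma twist_sum: "\<sigma> (sum f A) = (\<Sum>i\<in>A. \<sigma> (f i))"
  using id_or_cnj by (auto simp: cnj_sum)

lemma chi_twist:
  "c \<in> carrier (chains1 G) \<Longrightarrow> chi G (\<lambda>r t. \<sigma> (a r t)) c = \<sigma> (chi G a c)"
  using id_or_cnj chi_cnj by auto

text \<open>Shaped like \<open>sesquilinear_form\<close>, so that \<sigma> = \<open>id\<close> and
  \<sigma> = \<open>cnj\<close> give the two required notions by unfolding. As \<sigma> is a
  multiplicative involution, the second clause amounts to \<sigma>-linearity.\<close>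

definition twisted_form ::
  "(complex \<Rightarrow> 'v \<Rightarrow> 'v::ab_group_add) \<Rightarrow> ('v \<Rightarrow> 'v \<Rightarrow> complex) \<Rightarrow> bool" where
  "twisted_form scale B \<longleftrightarrow>
     (\<forall>y. Vector_Spaces.linear scale (*) (\<lambda>x. B x y)) \<and>
     (\<forall>x. Vector_Spaces.linear scale (*) (\<lambda>y. \<sigma> (B x y)))"

lemma twisted_form_iff:
  assumes "vector_space scale"
  shows "twisted_form scale B \<longleftrightarrow>
    (\<forall>x x' y. B (x + x') y = B x y + B x' y) \<and> (\<forall>c x y. B (scale c x) y = c * B x y) \<and>
    (\<forall>x y y'. B x (y + y') = B x y + B x y') \<and> (\<forall>c x y. B x (scale c y) = \<sigma> c * B x y)"
proof -
  have "vector_space ((*) :: complex \<Rightarrow> complex \<Rightarrow> complex)"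
    by unfold_locales (simp_all add: algebra_simps)
  moreover have "\<sigma> x = \<sigma> y \<longleftrightarrow> x = y" for x y
    by (metis twist_simps(8))
  moreover have "\<sigma> x = y \<longleftrightarrow> x = \<sigma> y" for x y
    by (metis twist_simps(8))
  ultimately show ?thesis
    using assms by (auto simp: twisted_form_def Vector_Spaces.linear_iff)
qed

text \<open>Serves both to test invariance on basis vectors and to show that a form vanishing on the
  basis is zero.\<close>

lemma twisted_form_eqI:
  assumes vs: "vector_space scale" and span: "module.span scale A = UNIV"
    and B: "twisted_form scale B" "twisted_form scale B'"
    and eq: "\<And>x y. x \<in> A \<Longrightarrow> y \<in> A \<Longrightarrow> B x y = B' x y"
  shows "B x y = B' x y"
proof -
  interpret vector_space scale by (rule vs)
  note simps = B[unfolded twisted_form_iff[OF vs]]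
  have zero: "C 0 y = 0" "C x 0 = 0" if "twisted_form scale C" for C x y
    using that[unfolded twisted_form_iff[OF vs]] by (metis add_cancel_right_left)+
  have left: "B x y = B' x y" if "y \<in> A" for x y
  proof -
    have "x \<in> span A" by (simp add: span)
    then show ?thesis
      by (induction rule: span_induct) (auto simp: subspace_def simps zero[OF B(1)] zero[OF B(2)] eq that)
  qed
  have "y \<in> span A" by (simp add: span)
  then show ?thesis
    by (induction rule: span_induct) (auto simp: subspace_def simps zero[OF B(1)] zero[OF B(2)] left)
qed

text \<open>The form with Gram matrix \<beta>, written in coordinates, with \<sigma> applied to
  those of the second argument.\<close>

lemma twisted_form_exists:
  assumes vs: "vector_space scale" and fin: "finite S" and inj: "inj_on \<alpha> S"
    and indep: "\<not> module.dependent scale (\<alpha> ` S)" and span: "module.span scale (\<alpha> ` S) = UNIV"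
  obtains B where "twisted_form scale B"
    "\<And>s t. s \<in> S \<Longrightarrow> t \<in> S \<Longrightarrow> B (\<alpha> s) (\<alpha> t) = \<beta> s t"
proof -
  interpret vector_space scale by (rule vs)
  \<comment> \<open>Here \<open>representation\<close> gives the coordinates of a vector in the
    basis; it is not the predicate on group actions.\<close>
  let ?c = "representation (\<alpha> ` S)"
  let ?B = "\<lambda>x y. \<Sum>s\<in>S. \<Sum>t\<in>S. ?c x (\<alpha> s) * \<sigma> (?c y (\<alpha> t)) * \<beta> s t"
  have "twisted_form scale ?B"
    by (auto simp: twisted_form_iff[OF vs] representation_add[OF indep] representation_scale[OF indep]
        span algebra_simps sum.distrib sum_distrib_left)
  moreover have "?B (\<alpha> s) (\<alpha> t) = \<beta> s t" if "s \<in> S" "t \<in> S" for s t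
  proof -
    have coord: "?c (\<alpha> s) (\<alpha> s') = (if s' = s then 1 else 0)" if "s \<in> S" "s' \<in> S" for s s'
      using that inj by (auto simp: representation_basis[OF indep] inj_on_def)
    have "\<sigma> 1 = 1" using id_or_cnj by auto
    then have "?B (\<alpha> s) (\<alpha> t) = (\<Sum>s'\<in>S. \<Sum>t'\<in>S. if s' = s then if t' = t then \<beta> s t else 0 else 0)"
      using that by (intro sum.cong) (auto simp: coord)
    also have "\<dots> = (\<Sum>s'\<in>S. if s' = s then \<beta> s t else 0)"
      using that fin by (intro sum.cong) auto
    also have "\<dots> = \<beta> s t" using that fin by simp
    finally show ?thesis .
  qed
  ultimately show ?thesis using that by blast
qed

end

section \<open>The graph and the generators acting on the basis\<close>

text \<open>After division by the gcd, \<open>2 * k' < m'\<close> with \<open>k'\<close> positive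
  forces \<open>m'\<close> to be at least 3, whereas \<open>m = 2 * k\<close> has quotient
  2.\<close>

lemma div_gcd_ge_3_iff:
  fixes m k :: nat
  assumes "1 \<le> k" "2 * k \<le> m"
  shows "m div gcd m k \<ge> 3 \<longleftrightarrow> 2 * k \<noteq> m"
proof
  assume "m div gcd m k \<ge> 3"
  then show "2 * k \<noteq> m" using assms by (auto simp: gcd.commute)
next
  assume "2 * k \<noteq> m"
  then have lt: "2 * k < m" using assms by simp
  obtain k' where k: "k = gcd m k * k'" by (metis gcd_dvd2 dvdE)
  obtain m' where m: "m = gcd m k * m'" by (metis gcd_dvd1 dvdE)
  have g: "gcd m k > 0" using assms by simp
  have "gcd m k * (2 * k') < gcd m k * m'"
    using lt k m by (metis mult.left_commute)
  then have "2 * k' < m'" using g by simp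
  moreover have "k' \<noteq> 0" using k assms by (metis mult_0_right not_one_le_zero)
  moreover have "m div gcd m k = m'" using m g by (metis nonzero_mult_div_cancel_left less_numeral_extra(3))
  ultimately show "m div gcd m k \<ge> 3" by simp
qed

locale IR_setting =
  fixes W :: "('s, 'b) monoid_scheme" and S :: "'s set" and m :: "'s \<Rightarrow> 's \<Rightarrow> nat"
    and scale :: "complex \<Rightarrow> 'v \<Rightarrow> 'v::ab_group_add"
    and \<rho> :: "'s \<Rightarrow> 'v \<Rightarrow> 'v" and \<alpha> :: "'s \<Rightarrow> 'v"
    and k :: "'s \<Rightarrow> 's \<Rightarrow> nat" and a :: "'s \<Rightarrow> 's \<Rightarrow> complex"
  assumes coxeter: "coxeter_system W S m"
    and finite_S: "finite S"
    and IR: "IR_representation W S scale \<rho> \<alpha>"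
    and datum: "IR_datum S m k a"
    and defined: "defined_by_datum S m scale \<rho> \<alpha> k a"
    and conn: "connected (with_proj (Gtilde S m k))"
begin

abbreviation "G \<equiv> Gtilde S m k"

lemma vector_space: "vector_space scale" and hom: "\<rho> \<in> hom W (GL scale)"
  using IR by (simp_all add: IR_representation_def representation_def)

lemma basis: "inj_on \<alpha> S" "\<not> module.dependent scale (\<alpha> ` S)" "module.span scale (\<alpha> ` S) = UNIV"
  using IR by (simp_all add: IR_representation_def)

lemma group_W: "group W" and S_subset: "S \<subseteq> carrier W" and generate_S: "generate W S = carrier W"
  using coxeter by (simp_all add: coxeter_system_def group_presentation_def)

lemma linear_rho: "w \<in> carrier W \<Longrightarrow> Vector_Spaces.linear scale scale (\<rho> w)"
  and bij_rho: "w \<in> carrier W \<Longrightarrow> bij (\<rho> w)"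
  using hom by (auto simp: hom_def GL_def)

lemma rho_mult: "v \<in> carrier W \<Longrightarrow> w \<in> carrier W \<Longrightarrow> \<rho> (v \<otimes>\<^bsub>W\<^esub> w) x = \<rho> v (\<rho> w x)"
  using hom by (simp add: hom_def GL_def)

lemma rho_one: "\<rho> \<one>\<^bsub>W\<^esub> x = x"
proof -
  interpret group W by (rule group_W)
  \<comment> \<open>An idempotent injective map is the identity.\<close>
  have "\<rho> \<one>\<^bsub>W\<^esub> (\<rho> \<one>\<^bsub>W\<^esub> x) = \<rho> \<one>\<^bsub>W\<^esub> x"
    using rho_mult[OF one_closed one_closed] by simp
  then show ?thesis
    using bij_rho[OF one_closed] by (auto simp: bij_def inj_def)
qed

lemma invariant_form_iff_generators:
  "invariant_form W \<rho> B \<longleftrightarrow> (\<forall>r\<in>S. \<forall>x y. B (\<rho> r x) (\<rho> r y) = B x y)"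
proof
  assume "invariant_form W \<rho> B"
  then show "\<forall>r\<in>S. \<forall>x y. B (\<rho> r x) (\<rho> r y) = B x y"
    using S_subset by (auto simp: invariant_form_def)
next
  assume inv: "\<forall>r\<in>S. \<forall>x y. B (\<rho> r x) (\<rho> r y) = B x y"
  interpret group W by (rule group_W)
  have "\<forall>x y. B (\<rho> w x) (\<rho> w y) = B x y" if "w \<in> generate W S" for w
    using that
  proof (induction rule: generate.induct)
    case one
    show ?case by (simp add: rho_one)
  next
    case (incl r)
    then show ?case using inv by blast
  next
    case (inv r)
    then have r: "r \<in> carrier W" using S_subset by blast
    \<comment> \<open>Invariance under \<open>r\<close>, applied to the images of vectors under the
      inverse, yields invariance under the inverse.\<close>
    have "\<rho> r (\<rho> (inv\<^bsub>W\<^esub> r) x) = x" for x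
      using rho_mult[OF r inv_closed[OF r]] r by (simp add: rho_one)
    then show ?case using \<open>r \<in> S\<close> \<open>\<forall>r\<in>S. _\<close> by metis
  next
    case (eng v w)
    then show ?case by (simp add: rho_mult generate_S)
  qed
  then show "invariant_form W \<rho> B" by (simp add: invariant_form_def generate_S)
qed

text \<open>With the diagonal value \<open>-2\<close>, the defining equations of \<open>\<rho> r\<close> take a single shape.\<close>

definition coef :: "'s \<Rightarrow> 's \<Rightarrow> complex" where
  "coef r t = (if r = t then -2 else
     2 * (a r t / a t r) * complex_of_real (cos (real (k r t) * pi / real (m r t))))"

lemma rho_basis:
  assumes "r \<in> S" "t \<in> S"
  shows "\<rho> r (\<alpha> t) = \<alpha> t + scale (coef r t) (\<alpha> r)"
proof (cases "r = t")
  case True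
  interpret vector_space scale by (rule vector_space)
  have "scale (-2) (\<alpha> t) = - \<alpha> t - \<alpha> t"
    using scale_left_distrib[of "-1" "-1" "\<alpha> t"] by simp
  then show ?thesis
    using True assms defined by (simp add: defined_by_datum_def coef_def)
next
  case False
  then show ?thesis using assms defined by (auto simp: defined_by_datum_def coef_def)
qed

lemma datumD:
  assumes "r \<in> S" "t \<in> S" "r \<noteq> t"
  shows "k r t = k t r" "m r t = m t r" "1 \<le> k r t" "2 * k r t \<le> m r t" "a r t \<noteq> 0"
proof -
  show "k r t = k t r" "1 \<le> k r t" "a r t \<noteq> 0" "m r t = m t r"
    using assms datum coxeter
    by (auto simp: IR_datum_def coxeter_system_def coxeter_matrix_def)
  have "real (k r t) \<le> real (m r t) / 2"
    using assms datum by (auto simp: IR_datum_def)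
  then show "2 * k r t \<le> m r t" by linarith
qed

text \<open>The angle lies in the interval from 0 to pi/2, where cosine vanishes only at pi/2, that
  is, for \<open>2 * k r t = m r t\<close>. Hence \<open>coef\<close> is zero precisely on distinct
  non-adjacent pairs.\<close>

lemma arc_iff:
  assumes "r \<in> S" "t \<in> S" "r \<noteq> t"
  shows "(r, t) \<in> parcs G \<longleftrightarrow> cos (real (k r t) * pi / real (m r t)) \<noteq> 0"
proof -
  note d = datumD[OF assms]
  have m: "real (m r t) > 0" using d by linarith
  have "2 * k r t \<noteq> m r t \<longleftrightarrow> cos (real (k r t) * pi / real (m r t)) \<noteq> 0"
  proof
    assume "2 * k r t \<noteq> m r t"
    then have "2 * real (k r t) < real (m r t)" using d(4) by linarith
    then have "real (k r t) * pi / real (m r t) < pi / 2"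
      using m pi_gt_zero by (simp add: field_simps)
    moreover have "real (k r t) * pi / real (m r t) > - (pi / 2)"
      using m by (rule_tac less_le_trans[of _ 0]) auto
    ultimately show "cos (real (k r t) * pi / real (m r t)) \<noteq> 0"
      using cos_gt_zero_pi by fastforce
  next
    assume "cos (real (k r t) * pi / real (m r t)) \<noteq> 0"
    moreover have "real (k r t) * pi / real (2 * k r t) = pi / 2" using d(3) by simp
    ultimately show "2 * k r t \<noteq> m r t" by (metis cos_pi_half)
  qed
  then show ?thesis
    using assms div_gcd_ge_3_iff[OF d(3,4)] by (simp add: Gtilde_def)
qed

lemma arcD: "(r, t) \<in> parcs G \<Longrightarrow> r \<in> S \<and> t \<in> S \<and> r \<noteq> t"
  by (simp add: Gtilde_def)

lemma pverts_G: "pverts G = S"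
  by (simp add: Gtilde_def)

sublocale pair_graph G
proof
  show "finite (parcs G)"
    by (rule finite_subset[of _ "S \<times> S"]) (auto simp: Gtilde_def finite_S)
  show "symmetric (with_proj G)"
    using datumD(1,2) by (auto simp: symmetric_def Gtilde_def intro!: symI)
qed (auto simp: Gtilde_def finite_S)

end

section \<open>Invariant forms as potentials\<close>

locale twisted_IR_setting = IR_setting + conj_twist
begin

text \<open>On an edge both sides contain the same real cosine, which \<sigma> fixes and which
  cancels. Distinct non-adjacent pairs give 0 on both sides, and \<open>r = t\<close> is an
  identity.\<close>

lemma coef_iff_balanced:
  "(\<forall>r\<in>S. \<forall>t\<in>S. coef r t * b r = \<sigma> (coef t r) * b t) \<longleftrightarrow>
    balanced G (\<lambda>r t. a r t * \<sigma> (a r t)) b" (is "?L \<longleftrightarrow> ?R")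
proof -
  have "coef r t * b r = \<sigma> (coef t r) * b t \<longleftrightarrow>
      ((r, t) \<in> parcs G \<longrightarrow> b r * (a r t * \<sigma> (a r t)) = b t * (a t r * \<sigma> (a t r)))"
    if rt: "r \<in> S" "t \<in> S" for r t
  proof (cases "r = t")
    case True
    then show ?thesis by (auto simp: coef_def Gtilde_def)
  next
    case False
    let ?c = "complex_of_real (cos (real (k r t) * pi / real (m r t)))"
    have nz: "a r t \<noteq> 0" "a t r \<noteq> 0" "\<sigma> (a r t) \<noteq> 0"
      using datumD(5) rt False by auto
    have p: "coef r t = 2 * (a r t / a t r) * ?c" "\<sigma> (coef t r) = 2 * (\<sigma> (a t r) / \<sigma> (a r t)) * ?c"
      using False datumD(1,2)[OF rt False] by (simp_all add: coef_def)
    show ?thesis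
    proof (cases "?c = 0")
      case True
      then show ?thesis using arc_iff[OF rt False] p by simp
    next
      case c: False
      have "coef r t * b r = (a r t / a t r * b r) * (2 * ?c)"
        "\<sigma> (coef t r) * b t = (\<sigma> (a t r) / \<sigma> (a r t) * b t) * (2 * ?c)"
        by (simp_all add: p)
      then have "coef r t * b r = \<sigma> (coef t r) * b t \<longleftrightarrow>
          a r t / a t r * b r = \<sigma> (a t r) / \<sigma> (a r t) * b t"
        using c by (simp only: mult_cancel_right) simp
      also have "\<dots> \<longleftrightarrow> b r * (a r t * \<sigma> (a r t)) = b t * (a t r * \<sigma> (a t r))"
        using nz by (simp add: field_simps)
      finally show ?thesis using arc_iff[OF rt False] c by simp
    qed
  qed
  then show ?thesis using arcD by (fastforce simp: balanced_def)
qed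

text \<open>Since \<open>r\<close> negates \<open>\<alpha> r\<close>, invariance at a pair
  containing \<open>\<alpha> r\<close> determines its value from
  \<open>B (\<alpha> r) (\<alpha> r)\<close>. These pairs suffice, because \<open>r\<close> moves
  every basis vector by a multiple of \<open>\<alpha> r\<close>.\<close>

lemma invariant_form_iff_coef:
  assumes B: "twisted_form scale B"
  shows "invariant_form W \<rho> B \<longleftrightarrow> (\<forall>r\<in>S. \<forall>t\<in>S.
    2 * B (\<alpha> r) (\<alpha> t) = - \<sigma> (coef r t) * B (\<alpha> r) (\<alpha> r) \<and>
    2 * B (\<alpha> t) (\<alpha> r) = - coef r t * B (\<alpha> r) (\<alpha> r))"
    (is "_ \<longleftrightarrow> (\<forall>r\<in>S. \<forall>t\<in>S. ?E r t)")
proof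
  note simps = B[unfolded twisted_form_iff[OF vector_space]]
  have diag: "coef r r = -2" for r by (simp add: coef_def)
  {
    assume inv: "invariant_form W \<rho> B"
    show "\<forall>r\<in>S. \<forall>t\<in>S. ?E r t"
    proof (intro ballI)
      fix r t assume rt: "r \<in> S" "t \<in> S"
      have inv': "B (\<rho> r x) (\<rho> r y) = B x y" for x y
        using inv rt by (simp add: invariant_form_iff_generators)
      have "B (\<alpha> r) (\<alpha> t) = - B (\<alpha> r) (\<alpha> t) - \<sigma> (coef r t) * B (\<alpha> r) (\<alpha> r)"
        using inv'[of "\<alpha> r" "\<alpha> t"] by (simp add: rho_basis rt simps diag algebra_simps)
      moreover have "B (\<alpha> t) (\<alpha> r) = - B (\<alpha> t) (\<alpha> r) - coef r t * B (\<alpha> r) (\<alpha> r)"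
        using inv'[of "\<alpha> t" "\<alpha> r"] by (simp add: rho_basis rt simps diag algebra_simps)
      ultimately show "?E r t" by (simp add: algebra_simps eq_neg_iff_add_eq_0)
    qed
  next
    assume E: "\<forall>r\<in>S. \<forall>t\<in>S. ?E r t"
    have "B (\<rho> r x) (\<rho> r y) = B x y" if r: "r \<in> S" for r x y
    proof (rule twisted_form_eqI[OF vector_space basis(3) _ B])
      have lin: "\<rho> r (x + y) = \<rho> r x + \<rho> r y" "\<rho> r (scale c x) = scale c (\<rho> r x)" for c x y
        using linear_rho[of r] r S_subset by (auto simp: Vector_Spaces.linear_iff)
      show "twisted_form scale (\<lambda>x y. B (\<rho> r x) (\<rho> r y))"
        by (simp add: twisted_form_iff[OF vector_space] lin simps)
      fix x y assume "x \<in> \<alpha> ` S" "y \<in> \<alpha> ` S"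
      then obtain s t where st: "s \<in> S" "t \<in> S" "x = \<alpha> s" "y = \<alpha> t" by blast
      have 1: "2 * B (\<alpha> r) (\<alpha> t) = - \<sigma> (coef r t) * B (\<alpha> r) (\<alpha> r)"
        and 2: "2 * B (\<alpha> s) (\<alpha> r) = - coef r s * B (\<alpha> r) (\<alpha> r)"
        using E r st by blast+
      \<comment> \<open>Doubling lets both prescriptions be substituted directly; the two mixed
        terms then cancel the quadratic one.\<close>
      have "2 * B (\<rho> r x) (\<rho> r y) = 2 * B x y + coef r s * (2 * B (\<alpha> r) (\<alpha> t))
          + \<sigma> (coef r t) * (2 * B (\<alpha> s) (\<alpha> r))
          + 2 * coef r s * \<sigma> (coef r t) * B (\<alpha> r) (\<alpha> r)"
        by (simp add: rho_basis r st simps algebra_simps)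
      also have "\<dots> = 2 * B x y" unfolding 1 2 by (simp add: algebra_simps)
      finally show "B (\<rho> r x) (\<rho> r y) = B x y" by simp
    qed
    then show "invariant_form W \<rho> B" by (simp add: invariant_form_iff_generators)
  }
qed

lemma a_twist_nonzero: "(r, t) \<in> parcs G \<Longrightarrow> a r t * \<sigma> (a r t) \<noteq> 0"
  using arcD datumD(5) by simp

lemma invariant_form_exists_iff:
  "(\<exists>B. twisted_form scale B \<and> invariant_form W \<rho> B \<and> nonzero_form B) \<longleftrightarrow>
    (\<forall>c\<in>carrier (H1 G). chi G a c * \<sigma> (chi G a c) = 1)"
proof -
  let ?a = "\<lambda>r t. a r t * \<sigma> (a r t)"
  have "(\<exists>B. twisted_form scale B \<and> invariant_form W \<rho> B \<and> nonzero_form B) \<longleftrightarrow>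
    (\<exists>b. balanced G ?a b \<and> (\<forall>v\<in>pverts G. b v \<noteq> 0))" (is "?L \<longleftrightarrow> ?R")
  proof
    assume ?L
    then obtain B where B: "twisted_form scale B" "nonzero_form B"
      and inv: "invariant_form W \<rho> B" by blast
    have E: "2 * B (\<alpha> r) (\<alpha> t) = - \<sigma> (coef r t) * B (\<alpha> r) (\<alpha> r)"
      "2 * B (\<alpha> t) (\<alpha> r) = - coef r t * B (\<alpha> r) (\<alpha> r)" if "r \<in> S" "t \<in> S" for r t
      using inv that unfolding invariant_form_iff_coef[OF B(1)] by blast+
    let ?b = "\<lambda>r. B (\<alpha> r) (\<alpha> r)"
    have bal: "balanced G ?a ?b"
      unfolding coef_iff_balanced[symmetric]
    proof (intro ballI)
      fix r t assume "r \<in> S" "t \<in> S"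
      \<comment> \<open>The value \<open>B (\<alpha> t) (\<alpha> r)\<close> is prescribed once by
        \<open>r\<close> and once by \<open>t\<close>; the two must agree.\<close>
      then show "coef r t * ?b r = \<sigma> (coef t r) * ?b t"
        using E(2)[of r t] E(1)[of t r] by (metis mult_minus_left neg_equal_iff_equal)
    qed
    \<comment> \<open>The diagonal determines the whole Gram matrix, so a zero diagonal would make
      \<open>B\<close> zero. One nonzero entry then spreads over the connected graph.\<close>
    have "\<exists>u\<in>S. ?b u \<noteq> 0"
    proof (rule ccontr)
      assume "\<not> (\<exists>u\<in>S. ?b u \<noteq> 0)"
      then have "B (\<alpha> r) (\<alpha> t) = 0" if "r \<in> S" "t \<in> S" for r t
        using E(1)[OF that] that by simp
      moreover have "twisted_form scale (\<lambda>x y. 0)"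
        by (simp add: twisted_form_iff[OF vector_space])
      ultimately have "B x y = 0" for x y
        using twisted_form_eqI[OF vector_space basis(3) B(1), of "\<lambda>x y. 0"] by blast
      then show False using B(2) by (simp add: nonzero_form_def)
    qed
    then show ?R
      using bal balanced_nonzero[OF conn bal a_twist_nonzero] pverts_G by blast
  next
    assume ?R
    then obtain b where b: "balanced G ?a b" "\<And>v. v \<in> S \<Longrightarrow> b v \<noteq> 0"
      by (auto simp: pverts_G)
    \<comment> \<open>The Gram matrix is the prescription coming from the first index;
      \<open>coef r r = -2\<close> makes its diagonal equal to \<open>b\<close>.\<close>
    obtain B where B: "twisted_form scale B"
      "\<And>r t. r \<in> S \<Longrightarrow> t \<in> S \<Longrightarrow> B (\<alpha> r) (\<alpha> t) = - \<sigma> (coef r t) / 2 * b r"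
      by (rule twisted_form_exists[OF vector_space finite_S basis,
            where \<beta> = "\<lambda>r t. - \<sigma> (coef r t) / 2 * b r"]) (rule that)
    have diag: "B (\<alpha> r) (\<alpha> r) = b r" if "r \<in> S" for r
      using B(2)[OF that that] by (simp add: coef_def)
    have "invariant_form W \<rho> B"
      unfolding invariant_form_iff_coef[OF B(1)]
    proof (intro ballI conjI)
      fix r t assume rt: "r \<in> S" "t \<in> S"
      show "2 * B (\<alpha> r) (\<alpha> t) = - \<sigma> (coef r t) * B (\<alpha> r) (\<alpha> r)"
        by (simp add: diag rt B(2))
      \<comment> \<open>The prescription for the second index is not built into \<open>B\<close>; it
        is what balance provides.\<close>
      have "coef r t * b r = \<sigma> (coef t r) * b t"
        using b(1) rt by (simp add: coef_iff_balanced[symmetric])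
      then show "2 * B (\<alpha> t) (\<alpha> r) = - coef r t * B (\<alpha> r) (\<alpha> r)"
        by (simp add: diag[OF rt(1)] B(2) rt)
    qed
    moreover have "nonzero_form B"
    proof -
      obtain u where "u \<in> S"
        using conn by (auto simp: connected_def strongly_connected_def pverts_G)
      then show ?thesis using diag b(2) unfolding nonzero_form_def by metis
    qed
    ultimately show ?L using B(1) by blast
  qed
  also have "\<dots> \<longleftrightarrow> (\<forall>c\<in>carrier (H1 G). chi G ?a c = 1)"
    using chi_trivial_iff_balanced[OF conn a_twist_nonzero] by simp
  also have "\<dots> \<longleftrightarrow> (\<forall>c\<in>carrier (H1 G). chi G a c * \<sigma> (chi G a c) = 1)"
    by (auto simp: carrier_H1 chi_mult chi_twist)
  finally show ?thesis .
qed

end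

section \<open>The bilinear case \<sigma> = \<open>id\<close> and the sesquilinear case \<sigma> =
  \<open>cnj\<close>\<close>

theorem proposition6p1:
  fixes W :: "('s, 'b) monoid_scheme"
    and S :: "'s set"
    and m :: "'s \<Rightarrow> 's \<Rightarrow> nat"
    and scale :: "complex \<Rightarrow> 'v \<Rightarrow> 'v::ab_group_add"
    and \<rho> :: "'s \<Rightarrow> 'v \<Rightarrow> 'v"
    and \<alpha> :: "'s \<Rightarrow> 'v"
    and k :: "'s \<Rightarrow> 's \<Rightarrow> nat"
    and a :: "'s \<Rightarrow> 's \<Rightarrow> complex"
  assumes "coxeter_system W S m"
    and "finite S"
    and "\<forall>r\<in>S. \<forall>t\<in>S. m r t \<noteq> 0"
    and "IR_representation W S scale \<rho> \<alpha>"
    and "IR_datum S m k a"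
    and "defined_by_datum S m scale \<rho> \<alpha> k a"
    and "connected (with_proj (Gtilde S m k))"
  shows "((\<exists>B. bilinear_form scale B \<and> invariant_form W \<rho> B \<and> nonzero_form B) \<longleftrightarrow>
           chi (Gtilde S m k) a ` carrier (H1 (Gtilde S m k)) \<subseteq> {1, -1})
       \<and> ((\<exists>B. sesquilinear_form scale B \<and> invariant_form W \<rho> B \<and> nonzero_form B) \<longleftrightarrow>
           chi (Gtilde S m k) a ` carrier (H1 (Gtilde S m k)) \<subseteq> {z. cmod z = 1})"
proof -
  interpret IR_setting W S m scale \<rho> \<alpha> k a using assms by unfold_locales
  interpret bi: twisted_IR_setting W S m scale \<rho> \<alpha> k a id by unfold_locales simp
  interpret sesqui: twisted_IR_setting W S m scale \<rho> \<alpha> k a cnj by unfold_locales simp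
  have "bi.twisted_form scale B \<longleftrightarrow> bilinear_form scale B" for B
    by (simp add: bi.twisted_form_def bilinear_form_def)
  moreover have "sesqui.twisted_form scale B \<longleftrightarrow> sesquilinear_form scale B" for B
    by (simp add: sesqui.twisted_form_def sesquilinear_form_def)
  moreover have "z * id z = 1 \<longleftrightarrow> z \<in> {1, -1}" for z :: complex
    by (simp add: square_eq_1_iff)
  moreover have "z * cnj z = 1 \<longleftrightarrow> z \<in> {z. cmod z = 1}" for z
  proof -
    have "z * cnj z = 1 \<longleftrightarrow> (cmod z)\<^sup>2 = 1"
      unfolding complex_norm_square[symmetric] by (metis of_real_1 of_real_eq_iff)
    \<comment> \<open>The other square root, -1, is excluded because a norm is nonnegative.\<close>
    then show ?thesis by (simp add: power2_eq_1_iff) (smt (verit) norm_ge_zero)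
  qed
  ultimately show ?thesis
    using bi.invariant_form_exists_iff sesqui.invariant_form_exists_iff
    by (simp only: image_subset_iff)
qed

end
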